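(* Let $\nabla$ and $\tilde\nabla$ be the Levi-Civita connections of a Riemannian $\mathcal{W}_3$-manifold $(M,P,g)$ and its associated manifold $(M,P,\tilde g)$, respectively. Then under the transformation $\nabla\to\tilde\nabla$ the tensors $$S(x,y)=\nabla_xy+\tfrac12T(x,y),\qquad L(x,y)z=R(x,y)z+\tfrac12Q(x,y)z$$ are invariant, i.e. $\tilde S(x,y)=S(x,y)$ and $\tilde L(x,y)z=L(x,y)z$ for all smooth vector fields $x,y,z$ on $M$, where $\tilde S(x,y)=\tilde\nabla_xy+\tfrac12\tilde T(x,y)$ and $\tilde L(x,y)z=\tilde R(x,y)z+\tfrac12\tilde Q(x,y)z$.
   Context: A Riemannian almost product manifold $(M,P,g)$ is a smooth manifold $M$ with a $(1,1)$-tensor field $P$ and a Riemannian metric $g$ such that $P^2x=x$ and $g(Px,Py)=g(x,y)$ for all smooth vector fields $x,y$; it is assumed throughout that $\mathrm{tr}\,P=0$ (so $\dim M=2n$ is even). The associated manifold of $(M,P,g)$ is $(M,P,\tilde g)$, where $\tilde g(x,y)=g(x,Py)$ is an indefinite metric of signature $(n,n)$. Let $F(x,y,z)=g((\nabla_xP)y,z)$, where $\nabla$ is the Levi-Civita connection of $g$. A Riemannian $\mathcal{W}_3$-manifold is a Riemannian almost product manifold (with $\mathrm{tr}\,P=0$) satisfying $F(x,y,z)+F(y,z,x)+F(z,x,y)=0$ for all $x,y,z$. The curvature tensor of $\nabla$ is $R(x,y)z=\nabla_x\nabla_yz-\nabla_y\nabla_xz-\nabla_{[x,y]}z$, and $\tilde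 R$ is defined likewise from $\tilde\nabla$. The tensors $T$ and $Q$ are $$T(x,y)=-(\nabla_xP)Py-(\nabla_yP)Px,$$ $$Q(x,y)z=(\nabla_xT)(y,z)-(\nabla_yT)(x,z)+T(x,T(y,z))-T(y,T(x,z)),$$ and $\tilde T,\tilde Q$ are obtained by replacing $\nabla$ by $\tilde\nabla$: $$\tilde T(x,y)=-(\tilde\nabla_xP)Py-(\tilde\nabla_yP)Px,$$ $$\tilde Q(x,y)z=(\tilde\nabla_x\tilde T)(y,z)-(\tilde\nabla_y\tilde T)(x,z)+\tilde T(x,\tilde T(y,z))-\tilde T(y,\tilde T(x,z)).$$ The word "tensor" is the paper's term for $S$, which is understood simply as a map on pairs of smooth vector fields. *)

theory Defs
  imports "HOL-Analysis.Analysis" "HOL-Library.Function_Algebras"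
begin

instantiation "fun" :: (type, real_vector) real_vector
begin

definition scaleR_fun :: "real \<Rightarrow> ('a \<Rightarrow> 'b) \<Rightarrow> 'a \<Rightarrow> 'b"
  where "scaleR_fun c f = (\<lambda>x. c *\<^sub>R f x)"

instance
  by standard (simp_all add: scaleR_fun_def fun_eq_iff scaleR_add_right scaleR_add_left)

end

section \<open>Smooth manifolds\<close>

text \<open>The two predicates below are meant for open sets \<open>S\<close>: all derivatives are unrestricted.\<close>

fun Ck_on :: "nat \<Rightarrow> 'a::real_normed_vector set \<Rightarrow> ('a \<Rightarrow> 'b::real_normed_vector) \<Rightarrow> bool" where
  "Ck_on 0 S f \<longleftrightarrow> continuous_on S f"
| "Ck_on (Suc k) S f \<longleftrightarrow>
     (\<forall>x\<in>S. f differentiable (at x)) \<and>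
     (\<forall>v. Ck_on k S (\<lambda>x. frechet_derivative f (at x) v))"

definition smooth_on :: "'a::real_normed_vector set \<Rightarrow> ('a \<Rightarrow> 'b::real_normed_vector) \<Rightarrow> bool"
  where "smooth_on S f \<longleftrightarrow> (\<forall>k. Ck_on k S f)"

type_synonym ('m, 'e) atlas = "('m set \<times> ('m \<Rightarrow> 'e)) set"

text \<open>The underlying set of the manifold is the whole type \<open>'m\<close>; the manifold is Hausdorff and
  second countable by the sort of \<open>'m\<close>, and its dimension is \<open>DIM('e)\<close>. The atlas need not be
  maximal.\<close>

definition smooth_manifold ::
    "('m::{t2_space,second_countable_topology}, 'e::euclidean_space) atlas \<Rightarrow> bool"
  where "smooth_manifold A \<longleftrightarrow>
    (\<Union>(U, \<phi>)\<in>A. U) = UNIV \<and>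
    (\<forall>(U, \<phi>)\<in>A. open U \<and> open (\<phi> ` U) \<and> homeomorphism U (\<phi> ` U) \<phi> (inv_into U \<phi>)) \<and>
    (\<forall>(U, \<phi>)\<in>A. \<forall>(V, \<psi>)\<in>A. smooth_on (\<phi> ` (U \<inter> V)) (\<psi> \<circ> inv_into U \<phi>))"

definition smooth_functions ::
    "('m::{t2_space,second_countable_topology}, 'e::euclidean_space) atlas \<Rightarrow> ('m \<Rightarrow> real) set"
  where "smooth_functions A = {f. \<forall>(U, \<phi>)\<in>A. smooth_on (\<phi> ` U) (f \<circ> inv_into U \<phi>)}"

text \<open>A tangent vector at \<open>p\<close> is a derivation at \<open>p\<close> of the algebra of smooth functions. To make it
  unique as a HOL function, it is set to \<open>0\<close> on functions that are not smooth.\<close>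

type_synonym 'm tvector = "('m \<Rightarrow> real) \<Rightarrow> real"

definition tangent_space ::
    "('m::{t2_space,second_countable_topology}, 'e::euclidean_space) atlas \<Rightarrow> 'm \<Rightarrow> 'm tvector set"
  where "tangent_space A p = {v.
    (\<forall>f\<in>smooth_functions A. \<forall>h\<in>smooth_functions A. v (\<lambda>q. f q + h q) = v f + v h) \<and>
    (\<forall>c. \<forall>f\<in>smooth_functions A. v (\<lambda>q. c * f q) = c * v f) \<and>
    (\<forall>f\<in>smooth_functions A. \<forall>h\<in>smooth_functions A.
       v (\<lambda>q. f q * h q) = f p * v h + h p * v f) \<and>
    (\<forall>f. f \<notin> smooth_functions A \<longrightarrow> v f = 0)}"

type_synonym 'm vfield = "'m \<Rightarrow> 'm tvector"

definition vector_fields ::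
    "('m::{t2_space,second_countable_topology}, 'e::euclidean_space) atlas \<Rightarrow> 'm vfield set"
  where "vector_fields A = {X.
    (\<forall>p. X p \<in> tangent_space A p) \<and>
    (\<forall>f\<in>smooth_functions A. (\<lambda>p. X p f) \<in> smooth_functions A)}"

definition fmult :: "('m \<Rightarrow> real) \<Rightarrow> 'm vfield \<Rightarrow> 'm vfield"
  where "fmult f X = (\<lambda>p. f p *\<^sub>R X p)"

definition lie_bracket :: "'m vfield \<Rightarrow> 'm vfield \<Rightarrow> 'm vfield"
  where "lie_bracket X Y = (\<lambda>p f. X p (\<lambda>q. Y q f) - Y p (\<lambda>q. X q f))"

section \<open>Tensor fields of type (1,1) and metrics\<close>

type_synonym 'm endo_field = "'m \<Rightarrow> 'm tvector \<Rightarrow> 'm tvector"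

definition endo_apply :: "'m endo_field \<Rightarrow> 'm vfield \<Rightarrow> 'm vfield"
  where "endo_apply P X = (\<lambda>p. P p (X p))"

definition smooth_endo_field ::
    "('m::{t2_space,second_countable_topology}, 'e::euclidean_space) atlas \<Rightarrow> 'm endo_field \<Rightarrow> bool"
  where "smooth_endo_field A P \<longleftrightarrow>
    (\<forall>p. \<forall>u\<in>tangent_space A p. P p u \<in> tangent_space A p) \<and>
    (\<forall>p. \<forall>u\<in>tangent_space A p. \<forall>v\<in>tangent_space A p. P p (u + v) = P p u + P p v) \<and>
    (\<forall>p c. \<forall>u\<in>tangent_space A p. P p (c *\<^sub>R u) = c *\<^sub>R P p u) \<and>
    (\<forall>X\<in>vector_fields A. endo_apply P X \<in> vector_fields A)"

text \<open>Trace of a linear endomorphism \<open>L\<close> of a finite-dimensional subspace \<open>V\<close>: the sum of the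
  diagonal entries of its matrix in some basis of \<open>V\<close>.\<close>

definition trace_on :: "'v::real_vector set \<Rightarrow> ('v \<Rightarrow> 'v) \<Rightarrow> real"
  where "trace_on V L =
    (let B = (SOME B. independent B \<and> span B = V) in \<Sum>b\<in>B. representation B (L b) b)"

type_synonym 'm bilinear_field = "'m \<Rightarrow> 'm tvector \<Rightarrow> 'm tvector \<Rightarrow> real"

definition metric_apply :: "'m bilinear_field \<Rightarrow> 'm vfield \<Rightarrow> 'm vfield \<Rightarrow> 'm \<Rightarrow> real"
  where "metric_apply g X Y = (\<lambda>p. g p (X p) (Y p))"

definition riemannian_metric ::
    "('m::{t2_space,second_countable_topology}, 'e::euclidean_space) atlas \<Rightarrow>
      'm bilinear_field \<Rightarrow> bool"
  where "riemannian_metric A g \<longleftrightarrow>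
    (\<forall>p. \<forall>u\<in>tangent_space A p. \<forall>v\<in>tangent_space A p. g p u v = g p v u) \<and>
    (\<forall>p. \<forall>u\<in>tangent_space A p. \<forall>v\<in>tangent_space A p. \<forall>w\<in>tangent_space A p.
       g p (u + v) w = g p u w + g p v w) \<and>
    (\<forall>p c. \<forall>u\<in>tangent_space A p. \<forall>w\<in>tangent_space A p. g p (c *\<^sub>R u) w = c * g p u w) \<and>
    (\<forall>p. \<forall>u\<in>tangent_space A p. u \<noteq> 0 \<longrightarrow> g p u u > 0) \<and>
    (\<forall>X\<in>vector_fields A. \<forall>Y\<in>vector_fields A. metric_apply g X Y \<in> smooth_functions A)"

section \<open>Connections\<close>

text \<open>A connection is an operator on smooth vector fields; its values on other arguments are
  irrelevant.\<close>

type_synonym 'm conn = "'m vfield \<Rightarrow> 'm vfield \<Rightarrow> 'm vfield"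

definition connection ::
    "('m::{t2_space,second_countable_topology}, 'e::euclidean_space) atlas \<Rightarrow> 'm conn \<Rightarrow> bool"
  where "connection A nabla \<longleftrightarrow>
    (\<forall>X\<in>vector_fields A. \<forall>Y\<in>vector_fields A. nabla X Y \<in> vector_fields A) \<and>
    (\<forall>X\<in>vector_fields A. \<forall>Y\<in>vector_fields A. \<forall>Z\<in>vector_fields A.
       nabla (X + Y) Z = nabla X Z + nabla Y Z \<and>
       nabla X (Y + Z) = nabla X Y + nabla X Z) \<and>
    (\<forall>f\<in>smooth_functions A. \<forall>X\<in>vector_fields A. \<forall>Y\<in>vector_fields A.
       nabla (fmult f X) Y = fmult f (nabla X Y) \<and>
       nabla X (fmult f Y) = fmult (\<lambda>p. X p f) Y + fmult f (nabla X Y))"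

definition levi_civita ::
    "('m::{t2_space,second_countable_topology}, 'e::euclidean_space) atlas \<Rightarrow>
      'm bilinear_field \<Rightarrow> 'm conn \<Rightarrow> bool"
  where "levi_civita A h nabla \<longleftrightarrow>
    connection A nabla \<and>
    (\<forall>X\<in>vector_fields A. \<forall>Y\<in>vector_fields A. nabla X Y - nabla Y X = lie_bracket X Y) \<and>
    (\<forall>X\<in>vector_fields A. \<forall>Y\<in>vector_fields A. \<forall>Z\<in>vector_fields A.
       (\<lambda>p. X p (metric_apply h Y Z)) =
         metric_apply h (nabla X Y) Z + metric_apply h Y (nabla X Z))"

definition curvature :: "'m conn \<Rightarrow> 'm vfield \<Rightarrow> 'm vfield \<Rightarrow> 'm vfield \<Rightarrow> 'm vfield"
  where "curvature nabla X Y Z =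
    nabla X (nabla Y Z) - nabla Y (nabla X Z) - nabla (lie_bracket X Y) Z"

text \<open>\<open>(\<nabla>\<^sub>X P) Y\<close> for a tensor field of type (1,1).\<close>

definition cov_endo :: "'m conn \<Rightarrow> 'm endo_field \<Rightarrow> 'm vfield \<Rightarrow> 'm vfield \<Rightarrow> 'm vfield"
  where "cov_endo nabla P X Y = nabla X (endo_apply P Y) - endo_apply P (nabla X Y)"

text \<open>\<open>(\<nabla>\<^sub>X T) (Y, Z)\<close> for a tensor field of type (1,2).\<close>

definition cov_bilinear :: "'m conn \<Rightarrow> ('m vfield \<Rightarrow> 'm vfield \<Rightarrow> 'm vfield) \<Rightarrow>
    'm vfield \<Rightarrow> 'm vfield \<Rightarrow> 'm vfield \<Rightarrow> 'm vfield"
  where "cov_bilinear nabla T X Y Z = nabla X (T Y Z) - T (nabla X Y) Z - T Y (nabla X Z)"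

section \<open>Riemannian almost product manifolds\<close>

definition almost_product_manifold ::
    "('m::{t2_space,second_countable_topology}, 'e::euclidean_space) atlas \<Rightarrow>
      'm endo_field \<Rightarrow> 'm bilinear_field \<Rightarrow> bool"
  where "almost_product_manifold A P g \<longleftrightarrow>
    smooth_manifold A \<and> smooth_endo_field A P \<and> riemannian_metric A g \<and>
    (\<forall>X\<in>vector_fields A. endo_apply P (endo_apply P X) = X) \<and>
    (\<forall>X\<in>vector_fields A. \<forall>Y\<in>vector_fields A.
       metric_apply g (endo_apply P X) (endo_apply P Y) = metric_apply g X Y) \<and>
    (\<forall>p. trace_on (tangent_space A p) (P p) = 0)"

definition associated_metric :: "'m endo_field \<Rightarrow> 'm bilinear_field \<Rightarrow> 'm bilinear_field"
  where "associated_metric P g = (\<lambda>p u v. g p u (P p v))"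

definition tensor_F :: "'m conn \<Rightarrow> 'm endo_field \<Rightarrow> 'm bilinear_field \<Rightarrow>
    'm vfield \<Rightarrow> 'm vfield \<Rightarrow> 'm vfield \<Rightarrow> 'm \<Rightarrow> real"
  where "tensor_F nabla P g X Y Z = metric_apply g (cov_endo nabla P X Y) Z"

text \<open>The Levi-Civita connection of \<open>g\<close> exists and is unique on smooth vector fields, so the
  quantifier over \<open>nabla\<close> just names it.\<close>

definition W3_manifold ::
    "('m::{t2_space,second_countable_topology}, 'e::euclidean_space) atlas \<Rightarrow>
      'm endo_field \<Rightarrow> 'm bilinear_field \<Rightarrow> bool"
  where "W3_manifold A P g \<longleftrightarrow>
    almost_product_manifold A P g \<and>
    (\<forall>nabla. levi_civita A g nabla \<longrightarrow>
      (\<forall>X\<in>vector_fields A. \<forall>Y\<in>vector_fields A. \<forall>Z\<in>vector_fields A.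
        tensor_F nabla P g X Y Z + tensor_F nabla P g Y Z X + tensor_F nabla P g Z X Y = 0))"

definition tensor_T :: "'m conn \<Rightarrow> 'm endo_field \<Rightarrow> 'm vfield \<Rightarrow> 'm vfield \<Rightarrow> 'm vfield"
  where "tensor_T nabla P X Y =
    - cov_endo nabla P X (endo_apply P Y) - cov_endo nabla P Y (endo_apply P X)"

definition tensor_Q ::
    "'m conn \<Rightarrow> 'm endo_field \<Rightarrow> 'm vfield \<Rightarrow> 'm vfield \<Rightarrow> 'm vfield \<Rightarrow> 'm vfield"
  where "tensor_Q nabla P X Y Z =
    cov_bilinear nabla (tensor_T nabla P) X Y Z - cov_bilinear nabla (tensor_T nabla P) Y X Z
    + tensor_T nabla P X (tensor_T nabla P Y Z) - tensor_T nabla P Y (tensor_T nabla P X Z)"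

definition tensor_S :: "'m conn \<Rightarrow> 'm endo_field \<Rightarrow> 'm vfield \<Rightarrow> 'm vfield \<Rightarrow> 'm vfield"
  where "tensor_S nabla P X Y = nabla X Y + (1/2) *\<^sub>R tensor_T nabla P X Y"

definition tensor_L ::
    "'m conn \<Rightarrow> 'm endo_field \<Rightarrow> 'm vfield \<Rightarrow> 'm vfield \<Rightarrow> 'm vfield \<Rightarrow> 'm vfield"
  where "tensor_L nabla P X Y Z = curvature nabla X Y Z + (1/2) *\<^sub>R tensor_Q nabla P X Y Z"

end

theory Submission
  imports Defs
begin

text \<open>
  Subtracting the two Koszul formulas and using the cyclic identity for \<open>F\<close> gives
  \<open>\<nabla>~ = \<nabla> + T\<close>. The cyclic identity also yields \<open>T(x, Py) + T(Px, y) = 0\<close>, whence \<open>T~ = -T\<close>, so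
  \<open>S\<close> is the midpoint of the two connections. Since \<open>\<nabla>\<close> is torsion free, \<open>\<nabla>~ = \<nabla> + T\<close> implies
  \<open>R~ = R + Q\<close>; reading the same relation backwards, \<open>\<nabla> = \<nabla>~ + T~\<close> implies \<open>R = R~ + Q~\<close>. Hence
  \<open>Q~ = -Q\<close> and \<open>L\<close> is the midpoint of the two curvature tensors.
\<close>

section \<open>Vector fields\<close>

text \<open>On an open set a derivative depends only on the values inside the set. This is needed
  because \<open>frechet_derivative\<close> of a difference splits only at points where both
  functions are differentiable.\<close>

lemma Ck_on_cong:
  assumes "open S" "\<And>x. x \<in> S \<Longrightarrow> f x = h x"
  shows "Ck_on k S f \<longleftrightarrow> Ck_on k S h"
  using assms(2)
proof (induction k arbitrary: f h)
  case 0
  then show ?case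
    by (simp cong: continuous_on_cong)
next
  case (Suc k)
  have deriv: "(f has_derivative f') (at x) \<longleftrightarrow> (h has_derivative f') (at x)" if "x \<in> S" for x f'
    using has_derivative_transform_within_open[OF _ \<open>open S\<close> that, of f f' UNIV h]
      has_derivative_transform_within_open[OF _ \<open>open S\<close> that, of h f' UNIV f] Suc.prems
    by auto
  then have "frechet_derivative f (at x) = frechet_derivative h (at x)"
      "f differentiable (at x) \<longleftrightarrow> h differentiable (at x)" if "x \<in> S" for x
    using that by (simp_all add: frechet_derivative_def differentiable_def)
  moreover from this have "Ck_on k S (\<lambda>x. frechet_derivative f (at x) v) \<longleftrightarrow>
      Ck_on k S (\<lambda>x. frechet_derivative h (at x) v)" for v
    by (intro Suc.IH) simp
  ultimately show ?case
    by simp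
qed

lemma frechet_derivative_diff:
  assumes "f differentiable (at x)" "h differentiable (at x)"
  shows "frechet_derivative (\<lambda>x. f x - h x) (at x) =
    (\<lambda>v. frechet_derivative f (at x) v - frechet_derivative h (at x) v)"
  using assms by (intro frechet_derivative_at[symmetric] has_derivative_diff)
    (simp_all add: frechet_derivative_works[symmetric])

lemma Ck_on_diff:
  assumes "open S" "Ck_on k S f" "Ck_on k S h"
  shows "Ck_on k S (\<lambda>x. f x - h x)"
  using assms(2,3)
proof (induction k arbitrary: f h)
  case 0
  then show ?case
    by (simp add: continuous_on_diff)
next
  case (Suc k)
  have "Ck_on k S (\<lambda>x. frechet_derivative (\<lambda>x. f x - h x) (at x) v)" for v
  proof -
    have "Ck_on k S (\<lambda>x. frechet_derivative f (at x) v - frechet_derivative h (at x) v)"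
      using Suc by simp
    then show ?thesis
      using Suc.prems Ck_on_cong[OF \<open>open S\<close>,
          of "\<lambda>x. frechet_derivative (\<lambda>x. f x - h x) (at x) v"
            "\<lambda>x. frechet_derivative f (at x) v - frechet_derivative h (at x) v" k]
      by (simp add: frechet_derivative_diff)
  qed
  then show ?case
    using Suc.prems by simp
qed

lemma smooth_functions_diff:
  assumes "smooth_manifold A" "f \<in> smooth_functions A" "h \<in> smooth_functions A"
  shows "(\<lambda>q. f q - h q) \<in> smooth_functions A"
proof -
  have "smooth_on (\<phi> ` U) ((\<lambda>q. f q - h q) \<circ> inv_into U \<phi>)" if "(U, \<phi>) \<in> A" for U \<phi>
  proof -
    have "open (\<phi> ` U)"
      using assms(1) that by (auto simp: smooth_manifold_def)
    moreover have "smooth_on (\<phi> ` U) (f \<circ> inv_into U \<phi>)" "smooth_on (\<phi> ` U) (h \<circ> inv_into U \<phi>)"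
      using assms(2,3) that by (auto simp: smooth_functions_def)
    ultimately show ?thesis
      by (simp add: smooth_on_def o_def Ck_on_diff)
  qed
  then show ?thesis
    by (auto simp: smooth_functions_def)
qed

lemma tangent_space_diff:
  assumes "v \<in> tangent_space A p" "w \<in> tangent_space A p"
  shows "v - w \<in> tangent_space A p"
  using assms by (auto simp: tangent_space_def algebra_simps)

text \<open>Differences are treated first: zero, negatives and sums then follow algebraically, so
  smoothness is checked only once.\<close>

lemma vector_fields_diff:
  assumes "smooth_manifold A" "X \<in> vector_fields A" "Y \<in> vector_fields A"
  shows "X - Y \<in> vector_fields A"
  using assms by (auto simp: vector_fields_def tangent_space_diff smooth_functions_diff)

lemma vector_fields_zero:
  assumes "smooth_manifold A" "X \<in> vector_fields A"
  shows "0 \<in> vector_fields A"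
  using vector_fields_diff[OF assms(1) assms(2) assms(2)] by simp

lemma vector_fields_uminus:
  assumes "smooth_manifold A" "X \<in> vector_fields A"
  shows "- X \<in> vector_fields A"
  using vector_fields_diff[OF assms(1) vector_fields_zero[OF assms] assms(2)] by simp

lemma vector_fields_add:
  assumes "smooth_manifold A" "X \<in> vector_fields A" "Y \<in> vector_fields A"
  shows "X + Y \<in> vector_fields A"
  using vector_fields_diff[OF assms(1,2) vector_fields_uminus[OF assms(1,3)]] by simp

lemma vector_fields_tangent: "X \<in> vector_fields A \<Longrightarrow> X p \<in> tangent_space A p"
  by (simp add: vector_fields_def)

section \<open>Connections differing by a bilinear map\<close>

text \<open>Being torsion free, \<open>nabla\<close> splits \<open>T (lie_bracket X Y) Z\<close>
  into the two terms that complete the mixed terms to covariant derivatives of \<open>T\<close>. An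
  arbitrary \<open>T\<close> is allowed so that the formula can be applied in both directions
  between the two connections.\<close>

lemma curvature_add_bilinear:
  fixes nabla nabla' :: "'m conn"
    and T :: "'m vfield \<Rightarrow> 'm vfield \<Rightarrow> 'm vfield"
  assumes diff_closed: "\<And>X Y. X \<in> V \<Longrightarrow> Y \<in> V \<Longrightarrow> X - Y \<in> V"
    and closed: "\<And>X Y. X \<in> V \<Longrightarrow> Y \<in> V \<Longrightarrow> nabla X Y \<in> V"
    and T_closed: "\<And>X Y. X \<in> V \<Longrightarrow> Y \<in> V \<Longrightarrow> T X Y \<in> V"
    and add: "\<And>X Y Z. X \<in> V \<Longrightarrow> Y \<in> V \<Longrightarrow> Z \<in> V \<Longrightarrow> nabla X (Y + Z) = nabla X Y + nabla X Z"
    and T_add: "\<And>X Y Z. X \<in> V \<Longrightarrow> Y \<in> V \<Longrightarrow> Z \<in> V \<Longrightarrow> T X (Y + Z) = T X Y + T X Z"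
    and T_diff: "\<And>X Y Z. X \<in> V \<Longrightarrow> Y \<in> V \<Longrightarrow> Z \<in> V \<Longrightarrow> T (X - Y) Z = T X Z - T Y Z"
    and torsion: "\<And>X Y. X \<in> V \<Longrightarrow> Y \<in> V \<Longrightarrow> nabla X Y - nabla Y X = lie_bracket X Y"
    and nabla': "\<And>X Y. X \<in> V \<Longrightarrow> Y \<in> V \<Longrightarrow> nabla' X Y = nabla X Y + T X Y"
    and XYZ: "X \<in> V" "Y \<in> V" "Z \<in> V"
  shows "curvature nabla' X Y Z = curvature nabla X Y Z +
    (cov_bilinear nabla T X Y Z - cov_bilinear nabla T Y X Z + T X (T Y Z) - T Y (T X Z))"
proof -
  have expand: "nabla' X (nabla' Y Z) =
      nabla X (nabla Y Z) + nabla X (T Y Z) + T X (nabla Y Z) + T X (T Y Z)"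
    if "X \<in> V" "Y \<in> V" for X Y
  proof -
    \<comment> \<open>A sum written with differences only, since \<open>V\<close> is assumed closed
      just under these.\<close>
    have "nabla Y Z - ((T Y Z - T Y Z) - T Y Z) \<in> V"
      by (intro diff_closed closed T_closed that XYZ)
    then have "nabla Y Z + T Y Z \<in> V"
      by simp
    then show ?thesis
      using that XYZ by (simp add: nabla' closed T_closed add T_add add_ac)
  qed
  have bracket: "lie_bracket X Y \<in> V" "T (lie_bracket X Y) Z = T (nabla X Y) Z - T (nabla Y X) Z"
    using XYZ by (simp_all add: torsion[symmetric] diff_closed closed T_diff)
  show ?thesis
    unfolding curvature_def cov_bilinear_def expand[OF XYZ(1,2)] expand[OF XYZ(2,1)]
      nabla'[OF bracket(1) XYZ(3)] bracket(2)
    by (simp add: algebra_simps)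
qed

section \<open>The two Levi-Civita connections of a \<open>W\<^sub>3\<close>-manifold\<close>

locale W3_connections =
  fixes A :: "('m::{t2_space,second_countable_topology}, 'e::euclidean_space) atlas"
    and P :: "'m endo_field"
    and g :: "'m bilinear_field"
    and nabla nablat :: "'m conn"
  assumes W3: "W3_manifold A P g"
    and lc: "levi_civita A g nabla"
    and lct: "levi_civita A (associated_metric P g) nablat"
begin

abbreviation "V \<equiv> vector_fields A"
abbreviation "G \<equiv> metric_apply g"
abbreviation "PP \<equiv> endo_apply P"
abbreviation "D \<equiv> cov_endo nabla P"
abbreviation "T \<equiv> tensor_T nabla P"

lemma ap: "smooth_manifold A" "smooth_endo_field A P" "riemannian_metric A g"
  using W3 by (auto simp: W3_manifold_def almost_product_manifold_def)

lemmas V_add [simp] = vector_fields_add[OF ap(1)]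
lemmas V_diff [simp] = vector_fields_diff[OF ap(1)]
lemmas V_uminus [simp] = vector_fields_uminus[OF ap(1)]

section \<open>Linear algebra of \<open>P\<close> and \<open>g\<close> on vector fields\<close>

lemma P_closed [simp]: "X \<in> V \<Longrightarrow> PP X \<in> V"
  using ap(2) by (simp add: smooth_endo_field_def)

lemma P_P [simp]: "X \<in> V \<Longrightarrow> PP (PP X) = X"
  using W3 by (auto simp: W3_manifold_def almost_product_manifold_def)

lemma P_add: "X \<in> V \<Longrightarrow> Y \<in> V \<Longrightarrow> PP (X + Y) = PP X + PP Y"
  using ap(2) by (simp add: smooth_endo_field_def endo_apply_def fun_eq_iff vector_fields_tangent)

lemma P_diff: "X \<in> V \<Longrightarrow> Y \<in> V \<Longrightarrow> PP (X - Y) = PP X - PP Y"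
  using P_add[of "X - Y" Y] by (simp add: algebra_simps)

lemma P_uminus: "X \<in> V \<Longrightarrow> PP (- X) = - PP X"
  using P_add[of "- X" X] P_diff[of X X] by (simp add: eq_neg_iff_add_eq_0)

lemma G_sym: "X \<in> V \<Longrightarrow> Y \<in> V \<Longrightarrow> G X Y = G Y X"
  using ap(3) by (simp add: riemannian_metric_def metric_apply_def fun_eq_iff vector_fields_tangent)

lemma G_add_left: "X \<in> V \<Longrightarrow> Y \<in> V \<Longrightarrow> Z \<in> V \<Longrightarrow> G (X + Y) Z = G X Z + G Y Z"
  using ap(3) by (simp add: riemannian_metric_def metric_apply_def fun_eq_iff vector_fields_tangent)

lemma G_diff_left: "X \<in> V \<Longrightarrow> Y \<in> V \<Longrightarrow> Z \<in> V \<Longrightarrow> G (X - Y) Z = G X Z - G Y Z"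
  using G_add_left[of "X - Y" Y Z] by (simp add: algebra_simps)

lemma G_uminus_left: "X \<in> V \<Longrightarrow> Z \<in> V \<Longrightarrow> G (- X) Z = - G X Z"
  using G_add_left[of "- X" X Z] G_diff_left[of X X Z] by (simp add: eq_neg_iff_add_eq_0)

text \<open>An involutive isometry is self-adjoint: apply the isometry property to \<open>X\<close>
  and \<open>PP Y\<close>.\<close>

lemma G_P: "X \<in> V \<Longrightarrow> Y \<in> V \<Longrightarrow> G (PP X) Y = G X (PP Y)"
proof -
  assume "X \<in> V" "Y \<in> V"
  moreover have "G (PP X) (PP (PP Y)) = G X (PP Y)" if "X \<in> V" "Y \<in> V"
    using W3 that P_closed[of Y] unfolding W3_manifold_def almost_product_manifold_def by blast
  ultimately show ?thesis
    by simp
qed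

text \<open>The test field \<open>X - Y\<close> suffices, because \<open>g\<close> is positive
  definite at every point.\<close>

lemma G_cancel:
  assumes "X \<in> V" "Y \<in> V" "\<And>Z. Z \<in> V \<Longrightarrow> G X Z = G Y Z"
  shows "X = Y"
proof -
  have "G (X - Y) (X - Y) = 0"
    using assms by (simp add: G_diff_left)
  then have "g p ((X - Y) p) ((X - Y) p) = 0" for p
    by (simp add: metric_apply_def fun_eq_iff)
  moreover have "(X - Y) p \<in> tangent_space A p" for p
    using V_diff[OF assms(1,2)] by (rule vector_fields_tangent)
  ultimately have "(X - Y) p = 0" for p
    using ap(3) unfolding riemannian_metric_def by (metis less_irrefl)
  then have "X - Y = 0"
    by (simp add: fun_eq_iff)
  then show ?thesis
    by simp
qed

lemma nabla_closed [simp]: "X \<in> V \<Longrightarrow> Y \<in> V \<Longrightarrow> nabla X Y \<in> V"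
  and nabla_add_left: "X \<in> V \<Longrightarrow> Y \<in> V \<Longrightarrow> Z \<in> V \<Longrightarrow> nabla (X + Y) Z = nabla X Z + nabla Y Z"
  and nabla_add_right: "X \<in> V \<Longrightarrow> Y \<in> V \<Longrightarrow> Z \<in> V \<Longrightarrow> nabla X (Y + Z) = nabla X Y + nabla X Z"
  and nabla_torsion: "X \<in> V \<Longrightarrow> Y \<in> V \<Longrightarrow> nabla X Y - nabla Y X = lie_bracket X Y"
  and nabla_metric: "X \<in> V \<Longrightarrow> Y \<in> V \<Longrightarrow> Z \<in> V \<Longrightarrow>
    (\<lambda>p. X p (G Y Z)) = G (nabla X Y) Z + G Y (nabla X Z)"
  using lc unfolding levi_civita_def connection_def by blast+

text \<open>Expresses the indefinite metric through \<open>G\<close>, so that later identities can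
  all be tested with \<open>G_cancel\<close>.\<close>

lemma associated_metric_apply: "metric_apply (associated_metric P g) X Y = G X (PP Y)"
  by (simp add: metric_apply_def associated_metric_def endo_apply_def)

lemma nablat_closed [simp]: "X \<in> V \<Longrightarrow> Y \<in> V \<Longrightarrow> nablat X Y \<in> V"
  and nablat_add_right: "X \<in> V \<Longrightarrow> Y \<in> V \<Longrightarrow> Z \<in> V \<Longrightarrow> nablat X (Y + Z) = nablat X Y + nablat X Z"
  and nablat_torsion: "X \<in> V \<Longrightarrow> Y \<in> V \<Longrightarrow> nablat X Y - nablat Y X = lie_bracket X Y"
  and nablat_metric: "X \<in> V \<Longrightarrow> Y \<in> V \<Longrightarrow> Z \<in> V \<Longrightarrow>
    (\<lambda>p. X p (G Y (PP Z))) = G (nablat X Y) (PP Z) + G Y (PP (nablat X Z))"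
  using lct unfolding levi_civita_def connection_def associated_metric_apply by blast+

section \<open>Symmetries of the covariant derivative of \<open>P\<close>\<close>

lemma D_closed [simp]: "X \<in> V \<Longrightarrow> Y \<in> V \<Longrightarrow> D X Y \<in> V"
  by (simp add: cov_endo_def)

lemma D_add_right: "X \<in> V \<Longrightarrow> Y \<in> V \<Longrightarrow> Z \<in> V \<Longrightarrow> D X (Y + Z) = D X Y + D X Z"
  by (simp add: cov_endo_def nabla_add_right P_add)

lemma D_add_left: "X \<in> V \<Longrightarrow> Y \<in> V \<Longrightarrow> Z \<in> V \<Longrightarrow> D (X + Y) Z = D X Z + D Y Z"
  by (simp add: cov_endo_def nabla_add_left P_add)

text \<open>Covariant differentiation of \<open>P\<close> squared = identity.\<close>

lemma P_D: "X \<in> V \<Longrightarrow> Y \<in> V \<Longrightarrow> PP (D X Y) = - D X (PP Y)"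
  by (simp add: cov_endo_def P_diff)

lemma D_cyclic: "X \<in> V \<Longrightarrow> Y \<in> V \<Longrightarrow> Z \<in> V \<Longrightarrow> G (D X Y) Z + G (D Y Z) X + G (D Z X) Y = 0"
  using W3 lc unfolding W3_manifold_def tensor_F_def by blast

text \<open>Differentiate the self-adjointness relation \<open>G (PP Y) Z = G Y (PP Z)\<close> along
  \<open>X\<close>.\<close>

lemma D_sym:
  assumes "X \<in> V" "Y \<in> V" "Z \<in> V"
  shows "G (D X Y) Z = G (D X Z) Y"
proof -
  have "G (nabla X (PP Y)) Z + G (PP Y) (nabla X Z) = G (nabla X Y) (PP Z) + G Y (nabla X (PP Z))"
    using nabla_metric[of X "PP Y" Z] nabla_metric[of X Y "PP Z"] assms by (simp add: G_P)
  then show ?thesis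
    using assms
    by (simp add: cov_endo_def G_diff_left G_P G_sym[of Y] G_sym[of "PP Y"] algebra_simps)
qed

text \<open>The cyclic identity with its middle term turned around by \<open>D_sym\<close>; all
  later uses of the \<open>W3\<close> condition go through this form.\<close>

lemma D_sum_eq:
  assumes "X \<in> V" "Y \<in> V" "Z \<in> V"
  shows "G (D X Y + D Y X) Z = - G (D Z X) Y"
  using D_cyclic[OF assms] D_sym[of Y X Z] assms
  by (simp add: G_add_left eq_neg_iff_add_eq_0)

lemma T_closed [simp]: "X \<in> V \<Longrightarrow> Y \<in> V \<Longrightarrow> T X Y \<in> V"
  by (simp add: tensor_T_def)

lemma T_add_right: "X \<in> V \<Longrightarrow> Y \<in> V \<Longrightarrow> Z \<in> V \<Longrightarrow> T X (Y + Z) = T X Y + T X Z"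
  by (simp add: tensor_T_def P_add D_add_left D_add_right)

lemma T_sym: "T X Y = T Y X"
  by (simp add: tensor_T_def)

lemma T_diff_left: "X \<in> V \<Longrightarrow> Y \<in> V \<Longrightarrow> Z \<in> V \<Longrightarrow> T (X - Y) Z = T X Z - T Y Z"
  using T_add_right[of Z "X - Y" Y] by (simp add: T_sym[of Z] algebra_simps)

text \<open>Since \<open>P\<close> anticommutes with \<open>D X\<close>, applying it to
  \<open>T\<close> cancels both signs and both inner factors \<open>PP\<close>.\<close>

lemma P_T: "X \<in> V \<Longrightarrow> Y \<in> V \<Longrightarrow> PP (T X Y) = D X Y + D Y X"
  by (simp add: tensor_T_def P_diff P_uminus P_D)

section \<open>The difference of the two connections\<close>

lemma nablat_eq:
  assumes "X \<in> V" "Y \<in> V"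
  shows "nablat X Y = nabla X Y + T X Y"
proof -
  define W where "W X Y = nablat X Y - nabla X Y" for X Y
  have W_closed [simp]: "W X Y \<in> V" if "X \<in> V" "Y \<in> V" for X Y
    using that by (simp add: W_def)
  have W_sym: "W X Y = W Y X" if "X \<in> V" "Y \<in> V" for X Y
    using nabla_torsion[OF that] nablat_torsion[OF that] by (simp add: W_def algebra_simps)
  \<comment> \<open>The derivative of \<open>G Y (PP Z)\<close> along \<open>X\<close>, computed
    once with each connection.\<close>
  have W_metric: "G (PP (W X Y)) Z + G (PP (W X Z)) Y = G (D X Z) Y"
    if "X \<in> V" "Y \<in> V" "Z \<in> V" for X Y Z
  proof -
    have "G (nablat X Y) (PP Z) + G Y (PP (nablat X Z)) =
        G (nabla X Y) (PP Z) + G Y (nabla X (PP Z))"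
      using nabla_metric[of X Y "PP Z"] nablat_metric[of X Y Z] that by simp
    then show ?thesis
      using that
      by (simp add: W_def cov_endo_def P_diff G_diff_left G_P G_sym[of Y] algebra_simps)
  qed
  have "PP (W X Y) = D X Y + D Y X"
  proof (rule G_cancel)
    fix Z assume Z: "Z \<in> V"
    \<comment> \<open>Koszul's combination: \<open>W_metric\<close> for \<open>X\<close> and
      \<open>Y\<close> minus that for \<open>Z\<close>. The symmetry of \<open>W\<close> cancels
      everything but twice the wanted term.\<close>
    have "G (PP (W X Y)) Z + G (PP (W X Y)) Z =
        (G (PP (W X Y)) Z + G (PP (W X Z)) Y) + (G (PP (W Y X)) Z + G (PP (W Y Z)) X) -
        (G (PP (W Z Y)) X + G (PP (W Z X)) Y)"
      using W_sym[of X Y] W_sym[of X Z] W_sym[of Y Z] assms Z by (simp add: algebra_simps)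
    also have "\<dots> = G (D X Y) Z + G (D Y X) Z - G (D Z X) Y"
      using assms Z by (simp only: W_metric D_sym[of X Y Z] D_sym[of Y X Z])
    \<comment> \<open>The cyclic identity makes the last term a second copy of the first two, which
      matches the factor 2 on the left.\<close>
    also have "\<dots> = G (D X Y + D Y X) Z + G (D X Y + D Y X) Z"
      using D_sum_eq[of X Y Z] assms Z by (simp add: G_add_left)
    finally show "G (PP (W X Y)) Z = G (D X Y + D Y X) Z"
      by (simp add: fun_eq_iff)
  qed (use assms in simp_all)
  also have "\<dots> = PP (T X Y)"
    using assms by (simp add: P_T)
  finally have "PP (PP (W X Y)) = PP (PP (T X Y))"
    by simp
  then show ?thesis
    using assms by (simp add: W_def algebra_simps)
qed

text \<open>Paired with \<open>Z\<close>, the two summands become \<open>- G (D Z X) (PP Y)\<close>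
  and \<open>- G (D Z (PP X)) Y\<close>. They cancel because the self-adjoint \<open>P\<close>
  anticommutes with \<open>D Z\<close>.\<close>

lemma P_T_anti:
  assumes "X \<in> V" "Y \<in> V"
  shows "PP (T X (PP Y)) + PP (T (PP X) Y) = 0"
proof (rule G_cancel)
  show "G (PP (T X (PP Y)) + PP (T (PP X) Y)) Z = G 0 Z" if Z: "Z \<in> V" for Z
  proof -
    have "G (D Z (PP X)) Y = - G (D Z X) (PP Y)"
      using assms Z P_D[of Z X] by (simp add: G_P[symmetric] G_uminus_left)
    moreover have "G 0 Z = 0"
      using G_diff_left[of X X Z] assms Z by simp
    moreover have "PP (T X (PP Y)) + PP (T (PP X) Y) =
        (D X (PP Y) + D (PP Y) X) + (D (PP X) Y + D Y (PP X))"
      using assms by (simp add: P_T)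
    ultimately show ?thesis
      using assms Z D_sum_eq[of X "PP Y" Z] D_sum_eq[of "PP X" Y Z]
      by (simp only: G_add_left[of "D X (PP Y) + D (PP Y) X"] V_add D_closed P_closed) simp
  qed
  show "0 \<in> V"
    using V_diff[of X X] assms by simp
qed (use assms in simp_all)

lemma tensor_T_nablat:
  assumes "X \<in> V" "Y \<in> V"
  shows "tensor_T nablat P X Y = - T X Y"
proof -
  \<comment> \<open>The middle term is \<open>T X (PP (PP Y))\<close>, simplified by the
    involution.\<close>
  have cov: "cov_endo nablat P X (PP Y) = D X (PP Y) + T X Y - PP (T X (PP Y))"
    if "X \<in> V" "Y \<in> V" for X Y
    using that by (simp add: cov_endo_def nablat_eq P_add)
  \<comment> \<open>By symmetry of \<open>T\<close> the first three terms give
    \<open>- T X Y\<close>; the bracket vanishes by \<open>P_T_anti\<close>.\<close>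
  have "tensor_T nablat P X Y =
      T X Y - T X Y - T Y X + (PP (T X (PP Y)) + PP (T (PP X) Y))"
    using assms by (simp add: tensor_T_def[of nablat] cov T_sym[of Y])
      (simp add: tensor_T_def algebra_simps)
  then show ?thesis
    using assms by (simp add: P_T_anti T_sym[of Y])
qed

section \<open>Curvature and the invariance of \<open>S\<close> and \<open>L\<close>\<close>

lemma curvature_nablat:
  assumes "X \<in> V" "Y \<in> V" "Z \<in> V"
  shows "curvature nablat X Y Z = curvature nabla X Y Z + tensor_Q nabla P X Y Z"
  unfolding tensor_Q_def using assms
  by (intro curvature_add_bilinear[where V = V])
    (simp_all add: nabla_add_right T_add_right T_diff_left nabla_torsion nablat_eq)

text \<open>The difference of \<open>nabla\<close> from \<open>nablat\<close> is \<open>- T\<close>,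
  which is \<open>tensor_T nablat P\<close>, so \<open>curvature_add_bilinear\<close> applies in
  reverse and \<open>tensor_Q nablat\<close> need not be expanded.\<close>

lemma curvature_nabla:
  assumes "X \<in> V" "Y \<in> V" "Z \<in> V"
  shows "curvature nabla X Y Z = curvature nablat X Y Z + tensor_Q nablat P X Y Z"
  unfolding tensor_Q_def using assms
  by (intro curvature_add_bilinear[where V = V])
    (simp_all add: tensor_T_nablat nablat_add_right nablat_torsion T_add_right T_diff_left,
      simp add: nablat_eq)

lemma tensor_S_nablat:
  assumes "X \<in> V" "Y \<in> V"
  shows "tensor_S nablat P X Y = tensor_S nabla P X Y"
proof -
  have "T X Y = (1/2) *\<^sub>R T X Y + (1/2) *\<^sub>R T X Y"
    by (simp add: scaleR_add_left[symmetric])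
  then show ?thesis
    using assms by (simp add: tensor_S_def tensor_T_nablat nablat_eq algebra_simps)
qed

lemma tensor_L_nablat:
  assumes "X \<in> V" "Y \<in> V" "Z \<in> V"
  shows "tensor_L nablat P X Y Z = tensor_L nabla P X Y Z"
proof -
  let ?Q = "tensor_Q nabla P X Y Z"
  \<comment> \<open>Going to \<open>nablat\<close> and back returns the same curvature, so the two
    corrections add up to zero.\<close>
  have "tensor_Q nablat P X Y Z = - ?Q"
    using curvature_nablat[OF assms] curvature_nabla[OF assms] by (simp add: eq_neg_iff_add_eq_0)
  moreover have "?Q = (1/2) *\<^sub>R ?Q + (1/2) *\<^sub>R ?Q"
    by (simp add: scaleR_add_left[symmetric])
  ultimately show ?thesis
    by (simp add: tensor_L_def curvature_nablat[OF assms] algebra_simps)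
qed

end

theorem theorem5p1:
  fixes A :: "('m::{t2_space,second_countable_topology}, 'e::euclidean_space) atlas"
    and P :: "'m endo_field"
    and g :: "'m bilinear_field"
    and nabla nablat :: "'m conn"
  assumes "W3_manifold A P g"
    and "levi_civita A g nabla"
    and "levi_civita A (associated_metric P g) nablat"
  shows "(\<forall>X\<in>vector_fields A. \<forall>Y\<in>vector_fields A.
            tensor_S nablat P X Y = tensor_S nabla P X Y) \<and>
         (\<forall>X\<in>vector_fields A. \<forall>Y\<in>vector_fields A. \<forall>Z\<in>vector_fields A.
            tensor_L nablat P X Y Z = tensor_L nabla P X Y Z)"
proof -
  interpret W3_connections A P g nabla nablat
    using assms by unfold_locales
  show ?thesis
    by (simp add: tensor_S_nablat tensor_L_nablat)
qed

end
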